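(* Let $H$ be an infinite-dimensional separable complex Hilbert space. Then $\beta(H)$ is dense in $\mathcal{B}(H)$ with respect to the operator norm.
   Context: $\mathcal{B}(H)$ is the algebra of bounded linear operators on $H$. A closed subspace $M\subseteq H$ is reducing for $T\in\mathcal{B}(H)$ if $TM\subseteq M$ and $TM^\perp\subseteq M^\perp$; $\mathcal{R}_T$ denotes the collection of all reducing subspaces of $T$. For $M\in\mathcal{R}_T$ non-zero, the restriction $T|_M$ is norm attaining if there is a unit vector $x\in M$ with $\|Tx\|=\|T|_M\|$, where $\|T|_M\|=\sup\{\|Ty\|:y\in M,\|y\|=1\}$. The class $\beta(H)$ is $$\beta(H):=\{T\in\mathcal{B}(H): T|_M \text{ is norm attaining for every non-zero } M\in\mathcal{R}_T\}.$$ *)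

theory Defs
  imports "HOL-Analysis.Analysis"
begin

text \<open>
  A complex inner product space is presented as a real inner product space carrying a compatible
  complex scalar multiplication and a sesquilinear form whose real part is the real inner product.
  Positive definiteness of the complex form and \<open>norm x = sqrt (Re (cinner x x))\<close>
  are thus inherited from \<open>real_inner\<close>, and every complex inner product space arises in this way.
\<close>

class complex_inner = real_inner +
  fixes scaleC :: "complex \<Rightarrow> 'a \<Rightarrow> 'a"  (infixr "*\<^sub>C" 75)
    and cinner :: "'a \<Rightarrow> 'a \<Rightarrow> complex"
  assumes scaleC_add_right: "a *\<^sub>C (x + y) = a *\<^sub>C x + a *\<^sub>C y"
    and scaleC_add_left: "(a + b) *\<^sub>C x = a *\<^sub>C x + b *\<^sub>C x"
    and scaleC_scaleC: "a *\<^sub>C (b *\<^sub>C x) = (a * b) *\<^sub>C x"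
    and scaleC_of_real: "complex_of_real r *\<^sub>C x = r *\<^sub>R x"
    and cinner_commute: "cinner x y = cnj (cinner y x)"
    and cinner_add_left: "cinner (x + y) z = cinner x z + cinner y z"
    and cinner_scaleC_left: "cinner (a *\<^sub>C x) y = a * cinner x y"
    and inner_eq_Re_cinner: "inner x y = Re (cinner x y)"

lemma norm_eq_sqrt_cinner: "norm x = sqrt (Re (cinner x x))" for x :: "'a::complex_inner"
  by (simp add: norm_eq_sqrt_inner inner_eq_Re_cinner)

lemma cinner_self: "cinner x x = complex_of_real ((norm x)\<^sup>2)" for x :: "'a::complex_inner"
proof -
  have "Im (cinner x x) = 0"
    using cinner_commute[of x x] by (metis cnj.simps(2) neg_equal_zero)
  then show ?thesis
    by (simp add: complex_eq_iff power2_norm_eq_inner inner_eq_Re_cinner)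
qed

global_interpretation complex_vector: vector_space "scaleC :: complex \<Rightarrow> 'a \<Rightarrow> 'a::complex_inner"
  defines csubspace = complex_vector.subspace
    and cspan = complex_vector.span
proof
  show "1 *\<^sub>C x = x" for x :: 'a
    using scaleC_of_real[of 1 x] by simp
qed (rule scaleC_add_right scaleC_add_left scaleC_scaleC)+

class complex_hilbert = complex_inner + complete_space

definition ortho_compl :: "'a::complex_inner set \<Rightarrow> 'a set"
  where "ortho_compl M = {y. \<forall>x\<in>M. cinner x y = 0}"

text \<open>
  The type of bounded linear functions of the library consists of the real-linear ones; its norm
  is the operator norm.
\<close>

definition bounded_operators :: "('a::complex_inner \<Rightarrow>\<^sub>L 'a) set"
  where "bounded_operators = {T. \<forall>c x. blinfun_apply T (c *\<^sub>C x) = c *\<^sub>C blinfun_apply T x}"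

definition reducing_subspaces :: "('a::complex_inner \<Rightarrow>\<^sub>L 'a) \<Rightarrow> 'a set set"
  where "reducing_subspaces T =
    {M. csubspace M \<and> closed M \<and> blinfun_apply T ` M \<subseteq> M \<and>
        blinfun_apply T ` ortho_compl M \<subseteq> ortho_compl M}"

definition restriction_norm :: "('a::complex_inner \<Rightarrow>\<^sub>L 'a) \<Rightarrow> 'a set \<Rightarrow> real"
  where "restriction_norm T M = (SUP y\<in>{y\<in>M. norm y = 1}. norm (blinfun_apply T y))"

definition norm_attaining_on :: "('a::complex_inner \<Rightarrow>\<^sub>L 'a) \<Rightarrow> 'a set \<Rightarrow> bool"
  where "norm_attaining_on T M \<longleftrightarrow>
    (\<exists>x\<in>M. norm x = 1 \<and> norm (blinfun_apply T x) = restriction_norm T M)"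

definition beta_class :: "('a::complex_inner \<Rightarrow>\<^sub>L 'a) set"
  where "beta_class =
    {T \<in> bounded_operators. \<forall>M\<in>reducing_subspaces T. M \<noteq> {0} \<longrightarrow> norm_attaining_on T M}"

end

theory Submission
  imports Defs
begin

text \<open>
  Every operator \<open>T\<close> has an approximant \<open>S\<close> whose modulus has finite spectrum, and such an \<open>S\<close> attains
  its norm on every reducing subspace. The idea is the polar decomposition \<open>T = U R\<close> with \<open>R = |T|\<close>:
  replace \<open>R\<close> by a step operator \<open>D\<close>, a finite combination \<open>\<Sum>i. i e P\<^sub>i\<close> of mutually orthogonal spectral
  projections of \<open>R\<close> with \<open>\<parallel>R - D\<parallel> \<le> e\<close>, and put \<open>S = U D\<close>. Then \<open>\<parallel>T - S\<parallel> \<le> e\<close> and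
  \<open>\<parallel>S x\<parallel> = \<parallel>D x\<parallel>\<close> for all \<open>x\<close> (\<open>step_isometric_approximation\<close>). A subspace \<open>M\<close> that reduces \<open>S\<close> reduces
  \<open>D\<^sup>2\<close>, so \<open>M\<close> is the orthogonal sum of its intersections with the finitely many eigenspaces of \<open>D\<^sup>2\<close>, and
  any unit vector in the nonzero intersection with the largest eigenvalue attains the norm
  (\<open>step_isometric_attains_norm\<close>).

  The spectral projections come from positive square roots: the modulus of an operator is a norm limit
  of a fixed-point iteration (\<open>modulus_of_contraction\<close>), the modulus of \<open>R - t\<close> splits the space into a
  part where \<open>R \<ge> t\<close> and one where \<open>R \<le> t\<close> (\<open>spectral_cut\<close>), and repeated cuts at multiples of \<open>e\<close> give
  \<open>D\<close> (\<open>step_approximation\<close>).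

  All of this is done in real Hilbert spaces. Each operator constructed from \<open>T\<close> commutes with every
  operator that commutes with \<open>T\<close> and its adjoint, in particular with the multiplications by complex
  scalars if \<open>T\<close> is complex linear. So \<open>S\<close> is complex linear as well. On complex subspaces the real and
  the complex orthogonal complements coincide, so what holds for all reducing subspaces in the real
  sense holds for those in the complex sense.
\<close>

section \<open>Orthogonal projections and adjoints in a real Hilbert space\<close>

lemma exists_orthogonal_decomposition:
  fixes M :: "'a::{real_inner,banach} set"
  assumes "subspace M" and "closed M"
  shows "\<exists>y\<in>M. x - y \<in> M\<^sup>\<bottom>"
proof -
  define d where "d = infdist x M"
  have ne: "M \<noteq> {}" using subspace_0[OF assms(1)] by auto
  have d0: "d \<ge> 0" by (simp add: d_def infdist_nonneg)
  have dle: "d \<le> norm (x - y)" if "y \<in> M" for y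
    using infdist_le[OF that, of x] by (simp add: d_def dist_norm)
  have "\<exists>y\<in>M. (norm (x - y))\<^sup>2 < d\<^sup>2 + inverse (real (Suc n))" for n
  proof -
    have "d < sqrt (d\<^sup>2 + inverse (real (Suc n)))"
      by (rule real_less_rsqrt) simp
    then obtain y where "y \<in> M" "dist x y < sqrt (d\<^sup>2 + inverse (real (Suc n)))"
      unfolding d_def infdist_def using ne
      by (auto simp: cINF_less_iff)
    then have "(norm (x - y))\<^sup>2 < d\<^sup>2 + inverse (real (Suc n))"
      by (metis dist_norm norm_ge_zero real_sqrt_less_iff real_sqrt_abs abs_norm_cancel)
    with \<open>y \<in> M\<close> show ?thesis by blast
  qed
  then obtain Y where YM: "\<And>n. Y n \<in> M"
    and Yd: "\<And>n. (norm (x - Y n))\<^sup>2 < d\<^sup>2 + inverse (real (Suc n))"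
    by metis
  \<comment> \<open>The midpoint of two points of \<open>M\<close> is again at distance at least \<open>d\<close>, so the
    parallelogram law forces two near-minimizers to be close to each other.\<close>
  have close: "(norm (Y m - Y n))\<^sup>2 \<le> 4 * inverse (real (Suc N))" if "m \<ge> N" "n \<ge> N" for m n N
  proof -
    have "(1/2) *\<^sub>R (Y m + Y n) \<in> M"
      using YM assms(1) by (intro subspace_scale subspace_add)
    from dle[OF this] d0 have "d\<^sup>2 \<le> (norm (x - (1/2) *\<^sub>R (Y m + Y n)))\<^sup>2"
      by (rule power_mono)
    moreover have "(norm (Y m - Y n))\<^sup>2 = 2 * (norm (x - Y m))\<^sup>2 + 2 * (norm (x - Y n))\<^sup>2
        - 4 * (norm (x - (1/2) *\<^sub>R (Y m + Y n)))\<^sup>2"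
      by (simp add: power2_norm_eq_inner inner_diff_left inner_diff_right inner_add_left
          inner_add_right inner_commute algebra_simps)
    moreover have "inverse (real (Suc m)) \<le> inverse (real (Suc N))"
      "inverse (real (Suc n)) \<le> inverse (real (Suc N))"
      using that by (auto intro!: le_imp_inverse_le)
    ultimately show ?thesis using Yd[of m] Yd[of n] by linarith
  qed
  have "Cauchy Y"
  proof (rule CauchyI)
    fix e :: real assume "e > 0"
    then have "e\<^sup>2 / 4 > 0" by simp
    from reals_Archimedean[OF this] obtain N where N: "inverse (real (Suc N)) < e\<^sup>2 / 4" by blast
    have "norm (Y m - Y n) < e" if "m \<ge> N" "n \<ge> N" for m n
      using close[OF that] N \<open>e > 0\<close> by (intro power2_less_imp_less[of _ e]) auto
    then show "\<exists>N. \<forall>m\<ge>N. \<forall>n\<ge>N. norm (Y m - Y n) < e" by blast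
  qed
  then obtain y where y: "Y \<longlonglongrightarrow> y" using Cauchy_convergent convergent_def by blast
  have yM: "y \<in> M" using closed_sequentially[OF assms(2)] YM y by blast
  have "(norm (x - y))\<^sup>2 \<le> d\<^sup>2"
  proof (rule LIMSEQ_le)
    show "(\<lambda>n. (norm (x - Y n))\<^sup>2) \<longlonglongrightarrow> (norm (x - y))\<^sup>2" by (intro tendsto_intros y)
    have "(\<lambda>n. d\<^sup>2 + inverse (real (Suc n))) \<longlonglongrightarrow> d\<^sup>2 + 0"
      by (intro tendsto_intros LIMSEQ_inverse_real_of_nat)
    then show "(\<lambda>n. d\<^sup>2 + inverse (real (Suc n))) \<longlonglongrightarrow> d\<^sup>2" by simp
  qed (use Yd less_imp_le in blast)
  have "inner m (x - y) = 0" if m: "m \<in> M" for m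
  proof (cases "m = 0")
    case False
    define t where "t = inner m (x - y) / (norm m)\<^sup>2"
    have "y + t *\<^sub>R m \<in> M" using yM m assms(1) by (intro subspace_add subspace_scale)
    then have "d\<^sup>2 \<le> (norm (x - (y + t *\<^sub>R m)))\<^sup>2" using dle d0 by (intro power_mono) auto
    also have "\<dots> = (norm (x - y))\<^sup>2 - 2 * t * inner m (x - y) + t * (t * (norm m)\<^sup>2)"
      by (simp add: power2_norm_eq_inner inner_diff_left inner_diff_right inner_add_left
          inner_add_right inner_commute algebra_simps)
    also have "t * (norm m)\<^sup>2 = inner m (x - y)" using False by (simp add: t_def)
    finally have "t * inner m (x - y) \<le> 0" using \<open>(norm (x - y))\<^sup>2 \<le> d\<^sup>2\<close> by linarith
    then have "(inner m (x - y))\<^sup>2 / (norm m)\<^sup>2 \<le> 0" by (simp add: t_def power2_eq_square)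
    then show ?thesis using False by (auto simp: divide_le_0_iff)
  qed simp
  then show ?thesis using yM by (auto simp: orthogonal_comp_def orthogonal_def)
qed

definition orth_proj :: "'a::{real_inner,banach} set \<Rightarrow> 'a \<Rightarrow>\<^sub>L 'a"
  where "orth_proj M = Blinfun (\<lambda>x. SOME y. y \<in> M \<and> x - y \<in> M\<^sup>\<bottom>)"

lemma orthogonal_decomposition_unique:
  assumes "subspace M" "y \<in> M" "x - y \<in> M\<^sup>\<bottom>" "z \<in> M" "x - z \<in> M\<^sup>\<bottom>"
  shows "y = z"
proof -
  have "y - z \<in> M" using assms by (simp add: subspace_diff)
  moreover have "(x - z) - (x - y) \<in> M\<^sup>\<bottom>"
    by (rule subspace_diff[OF subspace_orthogonal_comp assms(5,3)])
  ultimately have "inner (y - z) (y - z) = 0"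
    by (auto simp: orthogonal_comp_def orthogonal_def)
  then show ?thesis by simp
qed

lemma
  fixes M :: "'a::{real_inner,banach} set"
  assumes M: "subspace M" "closed M"
  shows orth_proj_in: "orth_proj M x \<in> M"
    and orth_proj_diff: "x - orth_proj M x \<in> M\<^sup>\<bottom>"
proof -
  define f where "f = (\<lambda>x. SOME y. y \<in> M \<and> x - y \<in> M\<^sup>\<bottom>)"
  have f: "f x \<in> M \<and> x - f x \<in> M\<^sup>\<bottom>" for x
    unfolding f_def by (rule someI_ex) (use exists_orthogonal_decomposition[OF M] in blast)
  have uniq: "f x = y" if "y \<in> M" "x - y \<in> M\<^sup>\<bottom>" for x y
    using orthogonal_decomposition_unique[OF M(1)] f that by blast
  have "bounded_linear f"
  proof (rule bounded_linear_intro[where K = 1])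
    show "f (x + y) = f x + f y" for x y
    proof (rule uniq)
      show "f x + f y \<in> M" using f M(1) by (simp add: subspace_add)
      have "(x - f x) + (y - f y) \<in> M\<^sup>\<bottom>" using f by (intro subspace_add subspace_orthogonal_comp) auto
      then show "x + y - (f x + f y) \<in> M\<^sup>\<bottom>" by (simp add: algebra_simps)
    qed
    show "f (r *\<^sub>R x) = r *\<^sub>R f x" for r x
    proof (rule uniq)
      show "r *\<^sub>R f x \<in> M" using f M(1) by (simp add: subspace_scale)
      have "r *\<^sub>R (x - f x) \<in> M\<^sup>\<bottom>" using f by (intro subspace_scale subspace_orthogonal_comp) auto
      then show "r *\<^sub>R x - r *\<^sub>R f x \<in> M\<^sup>\<bottom>" by (simp add: algebra_simps)
    qed
    show "norm (f x) \<le> norm x * 1" for x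
    proof -
      have "inner (f x) (x - f x) = 0" using f[of x] by (auto simp: orthogonal_comp_def orthogonal_def)
      then have "(norm x)\<^sup>2 = (norm (f x))\<^sup>2 + (norm (x - f x))\<^sup>2"
        by (simp add: power2_norm_eq_inner inner_diff_left inner_diff_right inner_commute)
      then have "(norm (f x))\<^sup>2 \<le> (norm x)\<^sup>2" by simp
      then show ?thesis using power2_le_imp_le by fastforce
    qed
  qed
  then have "blinfun_apply (orth_proj M) = f"
    unfolding orth_proj_def f_def[symmetric] by (rule bounded_linear_Blinfun_apply)
  then show "orth_proj M x \<in> M" "x - orth_proj M x \<in> M\<^sup>\<bottom>" using f by auto
qed

lemma orth_proj_unique:
  fixes M :: "'a::{real_inner,banach} set"
  assumes "subspace M" "closed M" "y \<in> M" "x - y \<in> M\<^sup>\<bottom>"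
  shows "orth_proj M x = y"
  using orthogonal_decomposition_unique[OF assms(1)] orth_proj_in orth_proj_diff assms by metis

definition self_adjoint :: "('a::real_inner \<Rightarrow>\<^sub>L 'a) \<Rightarrow> bool"
  where "self_adjoint A \<longleftrightarrow> (\<forall>x y. inner (A x) y = inner x (A y))"

definition commutes :: "('a::real_normed_vector \<Rightarrow>\<^sub>L 'a) \<Rightarrow> ('a \<Rightarrow>\<^sub>L 'a) \<Rightarrow> bool"
  where "commutes A X \<longleftrightarrow> (\<forall>x. A (X x) = X (A x))"

lemma self_adjoint_orth_proj:
  fixes M :: "'a::{real_inner,banach} set"
  assumes "subspace M" "closed M"
  shows "self_adjoint (orth_proj M)"
proof -
  have "inner (orth_proj M x) (y - orth_proj M y) = 0" for x y
    using orth_proj_in[OF assms, of x] orth_proj_diff[OF assms, of y]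
    by (auto simp: orthogonal_comp_def orthogonal_def)
  then have "inner (orth_proj M x) y = inner (orth_proj M x) (orth_proj M y)" for x y
    by (simp add: inner_diff_right)
  then show ?thesis unfolding self_adjoint_def by (metis inner_commute)
qed

text \<open>
  A functional with kernel \<open>K\<close> is represented by a multiple of any vector \<open>w\<close> orthogonal to \<open>K\<close> with
  \<open>f w \<noteq> 0\<close>, because \<open>x - (f x / f w) w\<close> lies in \<open>K\<close> for every \<open>x\<close>.
\<close>

lemma riesz_representation:
  fixes f :: "'a::{real_inner,banach} \<Rightarrow> real"
  assumes f: "bounded_linear f"
  shows "\<exists>z. \<forall>x. f x = inner z x"
proof (cases "\<forall>x. f x = 0")
  case True
  then show ?thesis by (intro exI[of _ 0]) simp
next
  case False
  then obtain a where a: "f a \<noteq> 0" by blast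
  interpret f: bounded_linear f by fact
  define K where "K = {x. f x = 0}"
  have K: "subspace K" "closed K"
    unfolding K_def
    by (auto simp: subspace_def f.add f.scaleR intro!: closed_Collect_eq
        linear_continuous_on f continuous_intros)
  define w where "w = a - orth_proj K a"
  have "f (orth_proj K a) = 0" using orth_proj_in[OF K] by (auto simp: K_def)
  then have fw: "f w \<noteq> 0" using a by (simp add: w_def f.diff)
  have "f x = inner ((f w / (norm w)\<^sup>2) *\<^sub>R w) x" for x
  proof -
    have "f (x - (f x / f w) *\<^sub>R w) = 0" using fw by (simp add: f.diff f.scaleR)
    then have "inner (x - (f x / f w) *\<^sub>R w) w = 0"
      using orth_proj_diff[OF K, of a]
      by (auto simp: orthogonal_comp_def orthogonal_def w_def K_def)
    then have "inner w x = f x / f w * (norm w)\<^sup>2"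
      by (simp add: inner_diff_left inner_diff_right power2_norm_eq_inner inner_commute)
    moreover have "w \<noteq> 0" using fw f.zero by auto
    ultimately show ?thesis using fw by (simp add: field_simps)
  qed
  then show ?thesis by blast
qed

definition adjoint_op :: "('a::{real_inner,banach} \<Rightarrow>\<^sub>L 'a) \<Rightarrow> 'a \<Rightarrow>\<^sub>L 'a"
  where "adjoint_op T = Blinfun (\<lambda>y. SOME z. \<forall>x. inner y (T x) = inner z x)"

lemma adjoint_op_inner:
  fixes T :: "'a::{real_inner,banach} \<Rightarrow>\<^sub>L 'a"
  shows "inner (adjoint_op T y) x = inner y (T x)"
proof -
  define f where "f = (\<lambda>y. SOME z. \<forall>x. inner y (T x) = inner z x)"
  have "bounded_linear (\<lambda>x. inner y (T x))" for y
    by (intro bounded_linear_intros)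
  then have f: "\<forall>x. inner y (T x) = inner (f y) x" for y
    unfolding f_def by (rule someI_ex[OF riesz_representation])
  have "bounded_linear f"
  proof (rule bounded_linear_intro[where K = "norm T"])
    show "f (x + y) = f x + f y" for x y
      by (rule vector_eq_rdot[THEN iffD1]) (simp add: inner_add_left f[rule_format, symmetric])
    show "f (r *\<^sub>R x) = r *\<^sub>R f x" for r x
      by (rule vector_eq_rdot[THEN iffD1]) (simp add: f[rule_format, symmetric])
    show "norm (f y) \<le> norm y * norm T" for y
    proof (cases "f y = 0")
      case False
      have "norm (f y) * norm (f y) = inner y (T (f y))"
        using f[of y] by (simp add: power2_norm_eq_inner power2_eq_square[symmetric])
      also have "\<dots> \<le> norm y * norm (T (f y))" by (rule norm_cauchy_schwarz)
      also have "\<dots> \<le> norm y * (norm T * norm (f y))"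
        by (intro mult_left_mono norm_blinfun) simp
      finally show ?thesis using False by (simp add: mult.assoc[symmetric])
    qed simp
  qed
  then have "blinfun_apply (adjoint_op T) = f"
    unfolding adjoint_op_def f_def[symmetric] by (rule bounded_linear_Blinfun_apply)
  then show ?thesis using f by simp
qed

lemma adjoint_op_inner_right: "inner x (adjoint_op T y) = inner (T x) y"
  by (metis adjoint_op_inner inner_commute)

lemma norm_adjoint_op_le: "norm (adjoint_op T x) \<le> norm T * norm x"
proof (cases "adjoint_op T x = 0")
  case False
  let ?y = "adjoint_op T x"
  have "norm ?y * norm ?y = inner x (T ?y)"
    by (metis adjoint_op_inner power2_norm_eq_inner power2_eq_square)
  also have "\<dots> \<le> norm x * norm (T ?y)" by (rule norm_cauchy_schwarz)
  also have "\<dots> \<le> norm x * (norm T * norm ?y)"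
    by (intro mult_left_mono norm_blinfun) simp
  finally show ?thesis using False by (simp add: mult.assoc[symmetric] mult.commute)
qed simp

section \<open>The modulus of an operator\<close>

text \<open>
  The positive square root of \<open>adjoint_op T o\<^sub>L T = 1 - B\<close> is \<open>R = 1 - Z\<close>, where \<open>Z\<close> solves
  \<open>Z = (B + Z\<^sup>2) / 2\<close>: indeed \<open>(1 - Z)\<^sup>2 = 1 - 2 Z + Z\<^sup>2 = 1 - B\<close>. As \<open>\<parallel>B\<parallel> \<le> 1\<close>, the iteration
  \<open>Y\<^sub>n\<^sub>+\<^sub>1 = (B + Y\<^sub>n\<^sup>2) / 2\<close> started at \<open>0\<close> is majorized by the scalar iteration
  \<open>y\<^sub>n\<^sub>+\<^sub>1 = (1 + y\<^sub>n\<^sup>2) / 2\<close>, which increases and stays below \<open>1\<close>; hence \<open>Y\<close> converges in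
  operator norm, even when \<open>\<parallel>B\<parallel> = 1\<close>. Self-adjointness and commutation relations pass to the limit,
  and \<open>\<parallel>Z\<parallel> \<le> 1\<close> makes \<open>R\<close> positive.
\<close>

lemma modulus_of_contraction:
  fixes T :: "'a::{real_inner,banach} \<Rightarrow>\<^sub>L 'a"
  assumes T: "norm T \<le> 1"
  shows "\<exists>R. self_adjoint R \<and> (\<forall>x. inner (R x) x \<ge> 0) \<and> (\<forall>x y. inner (R x) (R y) = inner (T x) (T y))
    \<and> (\<forall>X. commutes X (adjoint_op T o\<^sub>L T) \<longrightarrow> commutes X R)"
proof -
  define B where "B = id_blinfun - (adjoint_op T o\<^sub>L T)"
  have B_apply: "B x = x - adjoint_op T (T x)" for x by (simp add: B_def blinfun.diff_left)
  have normB: "norm B \<le> 1"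
  proof (rule norm_blinfun_bound)
    fix x
    have "norm (adjoint_op T (T x)) \<le> norm (T x)"
      using norm_adjoint_op_le[of T "T x"] T mult_right_mono[OF T, of "norm (T x)"] by simp
    then have "(norm (adjoint_op T (T x)))\<^sup>2 \<le> (norm (T x))\<^sup>2" by (simp add: power_mono)
    moreover have "(norm (B x))\<^sup>2
        = (norm x)\<^sup>2 - 2 * (norm (T x))\<^sup>2 + (norm (adjoint_op T (T x)))\<^sup>2"
      by (simp add: B_apply power2_norm_eq_inner inner_diff_left inner_diff_right
          adjoint_op_inner_right inner_commute)
    ultimately have "(norm (B x))\<^sup>2 \<le> (norm x)\<^sup>2"
      using zero_le_power2[of "norm (T x)"] by linarith
    then show "norm (B x) \<le> 1 * norm x" using power2_le_imp_le by fastforce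
  qed simp
  define Y where "Y n = ((\<lambda>Z. (1/2) *\<^sub>R (B + (Z o\<^sub>L Z))) ^^ n) 0" for n
  define y where "y n = ((\<lambda>z::real. (1/2) * (1 + z * z)) ^^ n) 0" for n
  have Y0: "Y 0 = 0" and YS: "Y (Suc n) = (1/2) *\<^sub>R (B + (Y n o\<^sub>L Y n))" for n
    by (simp_all add: Y_def)
  have y0: "y 0 = 0" and yS: "y (Suc n) = (1/2) * (1 + y n * y n)" for n
    by (simp_all add: y_def)
  have y01: "0 \<le> y n \<and> y n \<le> 1" for n
  proof (induction n)
    case (Suc n)
    then have "y n * y n \<le> 1" by (simp add: mult_le_one)
    with Suc show ?case by (simp add: yS)
  qed (simp add: y0)
  have yinc: "y n \<le> y (Suc n)" for n
    using zero_le_square[of "1 - y n"] by (simp add: yS algebra_simps)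
  have normY: "norm (Y n) \<le> y n" for n
  proof (induction n)
    case (Suc n)
    have "norm (Y n o\<^sub>L Y n) \<le> norm (Y n) * norm (Y n)" by (rule norm_blinfun_compose)
    also have "\<dots> \<le> y n * y n" using Suc y01 by (intro mult_mono) auto
    finally have "norm (B + (Y n o\<^sub>L Y n)) \<le> 1 + y n * y n"
      using normB norm_triangle_ineq[of B "Y n o\<^sub>L Y n"] by linarith
    then show ?case by (simp add: YS yS)
  qed (simp add: Y0 y0)
  have stepY: "norm (Y (Suc n) - Y n) \<le> y (Suc n) - y n" for n
  proof (induction n)
    case 0
    then show ?case using normB by (simp add: YS yS Y0 y0)
  next
    case (Suc n)
    let ?D = "Y (Suc n) - Y n"
    \<comment> \<open>\<open>U\<^sup>2 - V\<^sup>2 = U (U - V) + (U - V) V\<close>\<close>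
    have eq: "Y (Suc (Suc n)) - Y (Suc n) = (1/2) *\<^sub>R ((Y (Suc n) o\<^sub>L ?D) + (?D o\<^sub>L Y n))"
      unfolding YS[of "Suc n"]
      by (subst (3) YS) (simp add: blinfun_eqI blinfun.bilinear_simps algebra_simps)
    have "norm (Y (Suc n) o\<^sub>L ?D) \<le> norm (Y (Suc n)) * norm ?D" by (rule norm_blinfun_compose)
    also have "\<dots> \<le> y (Suc n) * (y (Suc n) - y n)"
      using Suc normY y01 by (intro mult_mono) auto
    finally have 1: "norm (Y (Suc n) o\<^sub>L ?D) \<le> y (Suc n) * (y (Suc n) - y n)" .
    have "norm (?D o\<^sub>L Y n) \<le> norm ?D * norm (Y n)" by (rule norm_blinfun_compose)
    also have "\<dots> \<le> (y (Suc n) - y n) * y n"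
      using Suc normY y01 yinc by (intro mult_mono) auto
    finally have 2: "norm (?D o\<^sub>L Y n) \<le> (y (Suc n) - y n) * y n" .
    have "norm (Y (Suc (Suc n)) - Y (Suc n))
        \<le> (1/2) * (y (Suc n) * (y (Suc n) - y n) + (y (Suc n) - y n) * y n)"
      unfolding eq using 1 2 norm_triangle_ineq[of "Y (Suc n) o\<^sub>L ?D" "?D o\<^sub>L Y n"] by simp
    also have "\<dots> = y (Suc (Suc n)) - y (Suc n)"
      unfolding yS[of "Suc n"] by (subst (6) yS) (simp add: algebra_simps)
    finally show ?case .
  qed
  have "Cauchy Y"
  proof -
    have "summable (\<lambda>n. y (Suc n) - y n)"
    proof -
      have "incseq y" using yinc by (rule incseq_SucI)
      then obtain l where "y \<longlonglongrightarrow> l" using incseq_convergent[of y 1] y01 by blast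
      then show ?thesis by (rule telescope_summable)
    qed
    then have "summable (\<lambda>n. Y (Suc n) - Y n)"
      by (rule summable_comparison_test'[where N = 0]) (use stepY in auto)
    then have "convergent (\<lambda>n. \<Sum>i<n. Y (Suc i) - Y i)"
      by (simp add: summable_iff_convergent)
    then show ?thesis by (simp add: sum_lessThan_telescope Y0 convergent_Cauchy)
  qed
  then obtain Z where Z: "Y \<longlonglongrightarrow> Z" using Cauchy_convergent convergent_def by blast
  have app: "(\<lambda>n. Y n x) \<longlonglongrightarrow> Z x" for x by (intro tendsto_intros Z)
  have fixp: "Z = (1/2) *\<^sub>R (B + (Z o\<^sub>L Z))"
  proof (rule LIMSEQ_unique)
    show "(\<lambda>n. Y (Suc n)) \<longlonglongrightarrow> Z" using Z by (rule LIMSEQ_Suc)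
    show "(\<lambda>n. Y (Suc n)) \<longlonglongrightarrow> (1/2) *\<^sub>R (B + (Z o\<^sub>L Z))"
      unfolding YS
      by (intro tendsto_intros bounded_bilinear.tendsto[OF bounded_bilinear_blinfun_compose] Z)
  qed
  have normZ: "norm Z \<le> 1"
    by (rule LIMSEQ_le_const2[OF tendsto_norm[OF Z]])
      (use normY y01 order_trans in blast)
  have saY: "self_adjoint (Y n)" for n
  proof (induction n)
    case (Suc n)
    then show ?case
      by (simp add: self_adjoint_def YS B_apply blinfun.bilinear_simps inner_add_left
          inner_add_right inner_diff_left inner_diff_right adjoint_op_inner adjoint_op_inner_right)
  qed (simp add: Y0 self_adjoint_def)
  have saZ: "inner (Z u) v = inner u (Z v)" for u v
  proof (rule LIMSEQ_unique)
    show "(\<lambda>n. inner (Y n u) v) \<longlonglongrightarrow> inner (Z u) v" by (intro tendsto_intros app)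
    have "(\<lambda>n. inner u (Y n v)) \<longlonglongrightarrow> inner u (Z v)" by (intro tendsto_intros app)
    then show "(\<lambda>n. inner (Y n u) v) \<longlonglongrightarrow> inner u (Z v)" using saY by (simp add: self_adjoint_def)
  qed
  define R where "R = id_blinfun - Z"
  have R_apply: "R x = x - Z x" for x by (simp add: R_def blinfun.diff_left)
  have saR: "self_adjoint R"
    by (simp add: self_adjoint_def R_apply inner_diff_left inner_diff_right saZ)
  have posR: "inner (R x) x \<ge> 0" for x
  proof -
    have "inner (Z x) x \<le> norm (Z x) * norm x" by (rule norm_cauchy_schwarz)
    also have "\<dots> \<le> norm x * norm x"
      using norm_blinfun[of Z x] mult_right_mono[OF normZ, of "norm x"]
      by (intro mult_right_mono) auto
    finally show ?thesis
      by (simp add: R_apply inner_diff_left power2_norm_eq_inner[symmetric] power2_eq_square)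
  qed
  have RR: "R (R x) = adjoint_op T (T x)" for x
  proof -
    have "Z x = (1/2) *\<^sub>R (B x + Z (Z x))"
      by (subst fixp) (simp add: blinfun.bilinear_simps)
    then have "2 *\<^sub>R Z x = 2 *\<^sub>R ((1/2) *\<^sub>R (B x + Z (Z x)))" by (rule arg_cong)
    then have "2 *\<^sub>R Z x = B x + Z (Z x)" by simp
    then show ?thesis
      by (simp add: R_apply B_apply blinfun.bilinear_simps scaleR_2 algebra_simps)
  qed
  have inR: "inner (R x) (R y) = inner (T x) (T y)" for x y
    using saR RR by (metis self_adjoint_def adjoint_op_inner_right)
  have "commutes X R" if X: "commutes X (adjoint_op T o\<^sub>L T)" for X
  proof -
    have XB: "X (B x) = B (X x)" for x
      using X by (simp add: commutes_def B_apply blinfun.bilinear_simps)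
    have XY: "X (Y n x) = Y n (X x)" for n x
    proof (induction n arbitrary: x)
      case (Suc n)
      then show ?case by (simp add: YS blinfun.bilinear_simps XB)
    qed (simp add: Y0 blinfun.bilinear_simps)
    have "X (Z x) = Z (X x)" for x
    proof (rule LIMSEQ_unique)
      show "(\<lambda>n. X (Y n x)) \<longlonglongrightarrow> X (Z x)" by (intro tendsto_intros app)
      show "(\<lambda>n. X (Y n x)) \<longlonglongrightarrow> Z (X x)" unfolding XY by (rule app)
    qed
    then show ?thesis by (simp add: commutes_def R_apply blinfun.bilinear_simps)
  qed
  with saR posR inR show ?thesis by blast
qed

lemma modulus_exists:
  fixes T :: "'a::{real_inner,banach} \<Rightarrow>\<^sub>L 'a"
  shows "\<exists>R. self_adjoint R \<and> (\<forall>x. inner (R x) x \<ge> 0) \<and> (\<forall>x y. inner (R x) (R y) = inner (T x) (T y))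
    \<and> (\<forall>X. commutes X (adjoint_op T o\<^sub>L T) \<longrightarrow> commutes X R)"
proof (cases "T = 0")
  case True
  then show ?thesis
    by (intro exI[of _ 0]) (auto simp: self_adjoint_def commutes_def blinfun.bilinear_simps)
next
  case False
  define c where "c = norm T"
  have c: "c > 0" using False by (simp add: c_def)
  define U where "U = inverse c *\<^sub>R T"
  have U_apply: "U x = inverse c *\<^sub>R T x" for x by (simp add: U_def blinfun.bilinear_simps)
  have "norm U \<le> 1" using c by (simp add: U_def c_def[symmetric])
  from modulus_of_contraction[OF this] obtain R where R: "self_adjoint R"
    "\<And>x. inner (R x) x \<ge> 0" "\<And>x y. inner (R x) (R y) = inner (U x) (U y)"
    "\<And>X. commutes X (adjoint_op U o\<^sub>L U) \<Longrightarrow> commutes X R" by blast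
  have adjU: "adjoint_op U y = inverse c *\<^sub>R adjoint_op T y" for y
    by (rule vector_eq_rdot[THEN iffD1]) (simp add: adjoint_op_inner U_apply)
  have "commutes X (adjoint_op U o\<^sub>L U)" if "commutes X (adjoint_op T o\<^sub>L T)" for X
    using that by (simp add: commutes_def adjU U_apply blinfun.bilinear_simps)
  then have "commutes X (c *\<^sub>R R)" if "commutes X (adjoint_op T o\<^sub>L T)" for X
    using that R(4)[of X] by (auto simp: commutes_def blinfun.bilinear_simps)
  moreover have "inner ((c *\<^sub>R R) x) ((c *\<^sub>R R) y) = inner (T x) (T y)" for x y
    using c by (simp add: blinfun.bilinear_simps R(3) U_apply field_simps)
  moreover have "self_adjoint (c *\<^sub>R R)"
    using R(1) by (simp add: self_adjoint_def blinfun.bilinear_simps)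
  moreover have "inner ((c *\<^sub>R R) x) x \<ge> 0" for x
    using R(2) c by (simp add: blinfun.bilinear_simps)
  ultimately show ?thesis by blast
qed

lemma kernel_closed_subspace:
  fixes N :: "'a::real_normed_vector \<Rightarrow>\<^sub>L 'a"
  shows "subspace {x. N x = 0}" "closed {x. N x = 0}"
  by (auto simp: subspace_def blinfun.bilinear_simps intro!: closed_Collect_eq continuous_intros)

section \<open>Cutting a self-adjoint operator at a threshold\<close>

text \<open>
  If \<open>X\<close> commutes with the self-adjoint \<open>N\<close>, then so does the adjoint of \<open>X\<close>; hence \<open>X\<close> maps the kernel
  of \<open>N\<close> and its orthogonal complement into themselves.
\<close>

lemma commutes_orth_proj_kernel:
  fixes N X :: "'a::{real_inner,banach} \<Rightarrow>\<^sub>L 'a"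
  assumes N: "self_adjoint N" and X: "commutes X N"
  shows "commutes X (orth_proj {x. N x = 0})"
proof -
  define K where "K = {x. N x = 0}"
  have K: "subspace K" "closed K" unfolding K_def by (rule kernel_closed_subspace)+
  have XN: "X (N z) = N (X z)" for z using X by (simp add: commutes_def)
  have "N (adjoint_op X k) = 0" if "k \<in> K" for k
  proof (rule vector_eq_rdot[THEN iffD1], intro allI)
    fix z
    have "inner (N (adjoint_op X k)) z = inner (adjoint_op X k) (N z)"
      using N by (simp add: self_adjoint_def)
    also have "\<dots> = inner k (N (X z))" by (simp add: adjoint_op_inner XN)
    also have "\<dots> = inner (N k) (X z)" using N by (simp add: self_adjoint_def)
    finally show "inner (N (adjoint_op X k)) z = inner 0 z" using that by (simp add: K_def)
  qed
  then have perp: "X y \<in> K\<^sup>\<bottom>" if "y \<in> K\<^sup>\<bottom>" for y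
    using that by (simp add: orthogonal_comp_def orthogonal_def K_def adjoint_op_inner[symmetric])
  have "orth_proj K (X x) = X (orth_proj K x)" for x
  proof (rule orth_proj_unique[OF K])
    show "X (orth_proj K x) \<in> K"
      using orth_proj_in[OF K, of x] by (simp add: K_def XN[symmetric] blinfun.bilinear_simps)
    show "X x - X (orth_proj K x) \<in> K\<^sup>\<bottom>"
      using perp[OF orth_proj_diff[OF K]] by (simp add: blinfun.bilinear_simps)
  qed
  then show ?thesis by (simp add: commutes_def K_def)
qed

text \<open>
  Here \<open>F\<close> is a spectral projection of \<open>R\<close> for the half-line from \<open>t\<close> upwards. With \<open>B = R - t\<close> and
  its modulus \<open>W\<close>, it projects onto the kernel of \<open>N = W - B\<close>, twice the negative part of \<open>B\<close>. On that
  kernel \<open>B = W \<ge> 0\<close>. Since \<open>W\<^sup>2 = B\<^sup>2\<close>, the range of \<open>W + B\<close> lies in the kernel of \<open>N\<close>; so on the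
  orthogonal complement, which \<open>W + B\<close> leaves invariant, \<open>W + B\<close> vanishes and \<open>B = - W \<le> 0\<close>.
\<close>

lemma spectral_cut:
  fixes R :: "'a::{real_inner,banach} \<Rightarrow>\<^sub>L 'a"
  assumes R: "self_adjoint R"
  shows "\<exists>F. self_adjoint F \<and> (\<forall>x. F (F x) = F x)
    \<and> (\<forall>x. t * (norm (F x))\<^sup>2 \<le> inner (R (F x)) (F x))
    \<and> (\<forall>x. inner (R (x - F x)) (x - F x) \<le> t * (norm (x - F x))\<^sup>2)
    \<and> (\<forall>X. commutes X R \<longrightarrow> commutes X F)"
proof -
  define B where "B = R - t *\<^sub>R id_blinfun"
  have B_apply: "B x = R x - t *\<^sub>R x" for x by (simp add: B_def blinfun.bilinear_simps)
  have saB: "self_adjoint B"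
    using R by (simp add: self_adjoint_def B_apply inner_diff_left inner_diff_right)
  obtain W where W: "self_adjoint W" "\<And>x. inner (W x) x \<ge> 0"
    "\<And>x y. inner (W x) (W y) = inner (B x) (B y)"
    "\<And>X. commutes X (adjoint_op B o\<^sub>L B) \<Longrightarrow> commutes X W"
    using modulus_exists[of B] by blast
  have adjB: "adjoint_op B x = B x" for x
    by (rule vector_eq_rdot[THEN iffD1]) (use saB in \<open>simp add: adjoint_op_inner self_adjoint_def\<close>)
  have WW: "W (W x) = B (B x)" for x
    by (rule vector_eq_rdot[THEN iffD1]) (use saB W(1,3) in \<open>simp add: self_adjoint_def\<close>)
  have XW: "commutes X W" if "commutes X B" for X
    using that by (intro W(4)) (simp add: commutes_def adjB)
  have BW: "B (W x) = W (B x)" for x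
    using XW[of B] by (simp add: commutes_def)
  define N where "N = W - B"
  have N_apply: "N x = W x - B x" for x by (simp add: N_def blinfun.bilinear_simps)
  have saN: "self_adjoint N"
    using saB W(1) by (simp add: self_adjoint_def N_apply inner_diff_left inner_diff_right)
  define F where "F = orth_proj {x. N x = 0}"
  note K = kernel_closed_subspace[of N]
  have FK: "N (F x) = 0" for x using orth_proj_in[OF K, of x] by (simp add: F_def)
  have Fid: "F x = x" if "N x = 0" for x
    unfolding F_def using that by (intro orth_proj_unique[OF K]) (auto simp: subspace_0 subspace_orthogonal_comp)
  have XF: "commutes X F" if "commutes X B" for X
    unfolding F_def using that XW[OF that]
    by (intro commutes_orth_proj_kernel[OF saN]) (simp add: commutes_def N_apply blinfun.bilinear_simps)
  have low: "t * (norm (F x))\<^sup>2 \<le> inner (R (F x)) (F x)" for x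
    using FK[of x] W(2)[of "F x"]
    by (simp add: N_apply B_apply inner_diff_left power2_norm_eq_inner)
  have up: "inner (R (x - F x)) (x - F x) \<le> t * (norm (x - F x))\<^sup>2" for x
  proof -
    let ?y = "x - F x"
    have Fy: "F ?y = 0" by (simp add: blinfun.bilinear_simps Fid FK)
    have "N (W ?y + B ?y) = 0" by (simp add: N_apply blinfun.bilinear_simps WW BW)
    then have "W ?y + B ?y = F (W ?y + B ?y)" by (simp add: Fid)
    also have "\<dots> = W (F ?y) + B (F ?y)"
      using XF[of W] XF[of B] BW by (simp add: commutes_def blinfun.add_right)
    finally have "W ?y + B ?y = 0" by (simp add: Fy blinfun.zero_right)
    then have "B ?y = - W ?y" by (simp add: eq_neg_iff_add_eq_0 add.commute)
    then have "inner (B ?y) ?y \<le> 0" using W(2)[of ?y] by simp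
    then show ?thesis by (simp add: B_apply inner_diff_left power2_norm_eq_inner)
  qed
  have "commutes X F" if "commutes X R" for X
    using that by (intro XF) (simp add: commutes_def B_apply blinfun.bilinear_simps)
  moreover have "self_adjoint F" unfolding F_def by (rule self_adjoint_orth_proj[OF K])
  ultimately show ?thesis using low up Fid FK by blast
qed

section \<open>Approximating a positive operator by a step operator\<close>

text \<open>
  The operator \<open>A (e - A)\<close> is positive because
  \<open>e A (e - A) = (e - A) A (e - A) + A (e - A) A\<close> is; this says \<open>\<parallel>A x\<parallel>\<^sup>2 \<le> e \<langle>A x, x\<rangle>\<close>.
\<close>

lemma norm_le_of_form_bounds:
  fixes A :: "'a::real_inner \<Rightarrow>\<^sub>L 'a"
  assumes A: "self_adjoint A" and e: "e > 0"
    and form: "\<And>x. 0 \<le> inner (A x) x \<and> inner (A x) x \<le> e * (norm x)\<^sup>2"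
  shows "norm (A x) \<le> e * norm x"
proof -
  define u where "u = e *\<^sub>R x - A x"
  have "inner (A u) u + (e * (norm (A x))\<^sup>2 - inner (A (A x)) (A x))
      = e * (e * inner (A x) x - (norm (A x))\<^sup>2)"
    using A
    by (simp add: u_def self_adjoint_def blinfun.bilinear_simps inner_diff_left inner_diff_right
        power2_norm_eq_inner algebra_simps inner_commute)
  moreover have "inner (A u) u \<ge> 0" "inner (A (A x)) (A x) \<le> e * (norm (A x))\<^sup>2"
    using form by auto
  ultimately have "0 \<le> e * (e * inner (A x) x - (norm (A x))\<^sup>2)" by linarith
  then have "(norm (A x))\<^sup>2 \<le> e * inner (A x) x" using e by (simp add: zero_le_mult_iff)
  also have "\<dots> \<le> e * (e * (norm x)\<^sup>2)" using form e by (intro mult_left_mono) auto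
  also have "\<dots> = (e * norm x)\<^sup>2" by (simp add: power2_eq_square)
  finally show ?thesis by (rule power2_le_imp_le) (use e in simp)
qed

text \<open>
  A projection-valued measure on \<open>{0..n}\<close>; some of the projections may be zero.
\<close>

definition orth_resolution :: "nat \<Rightarrow> (nat \<Rightarrow> 'a::real_inner \<Rightarrow>\<^sub>L 'a) \<Rightarrow> bool"
  where "orth_resolution n P \<longleftrightarrow> (\<forall>i\<le>n. self_adjoint (P i))
    \<and> (\<forall>i\<le>n. \<forall>j\<le>n. \<forall>x. P i (P j x) = (if i = j then P i x else 0))
    \<and> (\<forall>x. (\<Sum>i\<le>n. P i x) = x)"

definition step_op :: "real \<Rightarrow> nat \<Rightarrow> (nat \<Rightarrow> 'a::real_inner \<Rightarrow>\<^sub>L 'a) \<Rightarrow> 'a \<Rightarrow>\<^sub>L 'a"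
  where "step_op e n P = (\<Sum>i\<le>n. (real i * e) *\<^sub>R P i)"

lemma step_op_apply: "step_op e n P x = (\<Sum>i\<le>n. (real i * e) *\<^sub>R P i x)"
  by (simp add: step_op_def blinfun.sum_left blinfun.scaleR_left)

lemma norm_step_op:
  assumes P: "orth_resolution n P"
  shows "(norm (step_op e n P x))\<^sup>2 = (\<Sum>i\<le>n. (real i * e)\<^sup>2 * (norm (P i x))\<^sup>2)"
proof -
  have *: "inner (P i x) (P j x) = (if i = j then (norm (P i x))\<^sup>2 else 0)" if "i \<le> n" "j \<le> n" for i j
  proof -
    have "inner (P i x) (P j x) = inner x (P i (P j x))"
      using P that by (simp add: orth_resolution_def self_adjoint_def)
    also have "\<dots> = (if i = j then inner x (P i (P i x)) else 0)"
      using P that by (simp add: orth_resolution_def)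
    also have "inner x (P i (P i x)) = (norm (P i x))\<^sup>2"
      using P that by (simp add: orth_resolution_def self_adjoint_def power2_norm_eq_inner)
    finally show ?thesis .
  qed
  have "(norm (step_op e n P x))\<^sup>2
      = (\<Sum>i\<le>n. \<Sum>j\<le>n. (real i * e) * ((real j * e) * inner (P j x) (P i x)))"
    unfolding power2_norm_eq_inner step_op_apply
    by (simp add: inner_sum_left inner_sum_right sum_distrib_left)
  also have "\<dots> = (\<Sum>i\<le>n. (real i * e)\<^sup>2 * (norm (P i x))\<^sup>2)"
    by (intro sum.cong refl) (simp add: * sum.delta if_distrib[of "(*) _"] power2_eq_square mult.assoc cong: if_cong)
  finally show ?thesis .
qed

text \<open>
  Induction on the number of steps. With \<open>F\<close> the spectral cut of \<open>R\<close> at \<open>e\<close>, the operator \<open>R\<close> lies between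
  \<open>0\<close> and \<open>e\<close> on the range of \<open>1 - F\<close>, which becomes the eigenspace for \<open>0\<close>. The operator
  \<open>Q = (R - e) F\<close> needs one step fewer; the steps found for it, restricted to the range of \<open>F\<close> and raised
  by \<open>e\<close>, serve for \<open>R\<close> there. That \<open>P i\<close> commutes with whatever commutes with \<open>R\<close> makes these
  decompositions compatible with \<open>F\<close> in the induction, and later with the complex scalars.
\<close>

lemma step_approximation:
  fixes R :: "'a::{real_inner,banach} \<Rightarrow>\<^sub>L 'a"
  assumes e: "e > 0" and "self_adjoint R"
    and "\<And>x. 0 \<le> inner (R x) x \<and> inner (R x) x \<le> real (Suc n) * e * (norm x)\<^sup>2"
  shows "\<exists>P. orth_resolution n P \<and> (\<forall>i\<le>n. \<forall>X. commutes X R \<longrightarrow> commutes X (P i))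
    \<and> (\<forall>x. 0 \<le> inner (R x - step_op e n P x) x
         \<and> inner (R x - step_op e n P x) x \<le> e * (norm x)\<^sup>2)"
  using assms(2-)
proof (induction n arbitrary: R)
  case 0
  then show ?case
    by (intro exI[of _ "\<lambda>_. id_blinfun"])
      (simp add: orth_resolution_def self_adjoint_def commutes_def step_op_def)
next
  case (Suc n)
  note R = Suc.prems
  obtain F where saF: "self_adjoint F" and FF: "\<And>x. F (F x) = F x"
    and low: "\<And>x. e * (norm (F x))\<^sup>2 \<le> inner (R (F x)) (F x)"
    and up: "\<And>x. inner (R (x - F x)) (x - F x) \<le> e * (norm (x - F x))\<^sup>2"
    and comF: "\<And>X. commutes X R \<Longrightarrow> commutes X F"
    using spectral_cut[OF R(1), of e] by blast
  have Fin: "inner (F x) y = inner x (F y)" for x y using saF by (simp add: self_adjoint_def)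
  have Rin: "inner (R x) y = inner x (R y)" for x y using R(1) by (simp add: self_adjoint_def)
  have RF: "R (F x) = F (R x)" for x
    using comF[of R] by (simp add: commutes_def)
  define Q where "Q = (R - e *\<^sub>R id_blinfun) o\<^sub>L F"
  have Q_apply: "Q x = R (F x) - e *\<^sub>R F x" for x by (simp add: Q_def blinfun.bilinear_simps)
  have QF: "Q (F x) = F (Q x)" for x by (simp add: Q_apply FF RF blinfun.bilinear_simps)
  have saQ: "self_adjoint Q"
    by (simp add: self_adjoint_def Q_apply inner_diff_left inner_diff_right Rin Fin RF)
  have "inner (Q x) x = inner (Q (F x)) (F x)" for x
    by (metis Q_apply FF QF Fin)
  then have inQ: "inner (Q x) x = inner (R (F x)) (F x) - e * (norm (F x))\<^sup>2" for x
    by (simp add: Q_apply FF inner_diff_left power2_norm_eq_inner)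
  have pyth: "(norm x)\<^sup>2 = (norm (F x))\<^sup>2 + (norm (x - F x))\<^sup>2" for x
    by (simp add: power2_norm_eq_inner inner_diff_left inner_diff_right Fin FF)
  have "0 \<le> inner (Q x) x \<and> inner (Q x) x \<le> real (Suc n) * e * (norm x)\<^sup>2" for x
  proof -
    have "inner (Q x) x \<le> real (Suc n) * e * (norm (F x))\<^sup>2"
      using R(2)[of "F x"] by (simp add: inQ algebra_simps)
    also have "\<dots> \<le> real (Suc n) * e * (norm x)\<^sup>2"
      using e pyth[of x] by (intro mult_left_mono) auto
    finally show ?thesis using low[of x] by (simp add: inQ)
  qed
  from Suc.IH[OF saQ this] obtain P' where P': "orth_resolution n P'"
    and comP': "\<And>i X. i \<le> n \<Longrightarrow> commutes X Q \<Longrightarrow> commutes X (P' i)"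
    and form: "\<And>x. 0 \<le> inner (Q x - step_op e n P' x) x"
      "\<And>x. inner (Q x - step_op e n P' x) x \<le> e * (norm x)\<^sup>2"
    by blast
  have FP': "F (P' i x) = P' i (F x)" if "i \<le> n" for i x
    using comP'[OF that, of F] QF by (simp add: commutes_def)
  define P where "P i = (case i of 0 \<Rightarrow> id_blinfun - F | Suc k \<Rightarrow> P' k o\<^sub>L F)" for i
  have P0: "P 0 x = x - F x" and PS: "P (Suc k) x = P' k (F x)" for k x
    by (simp_all add: P_def blinfun.bilinear_simps)
  have "orth_resolution (Suc n) P"
    unfolding orth_resolution_def
  proof (intro conjI allI impI)
    fix i assume "i \<le> Suc n"
    then show "self_adjoint (P i)"
      using P' by (cases i)
        (simp_all add: self_adjoint_def P0 PS orth_resolution_def inner_diff_left inner_diff_right Fin FP')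
  next
    fix i j x assume "i \<le> Suc n" "j \<le> Suc n"
    then show "P i (P j x) = (if i = j then P i x else 0)"
      using P' by (cases i; cases j)
        (auto simp: P0 PS orth_resolution_def blinfun.bilinear_simps FF FP')
  next
    fix x
    show "(\<Sum>i\<le>Suc n. P i x) = x"
      using P' by (simp add: sum.atMost_Suc_shift P0 PS orth_resolution_def del: sum.atMost_Suc)
  qed
  moreover have "commutes X (P i)" if "i \<le> Suc n" and X: "commutes X R" for i X
  proof -
    have XF: "X (F x) = F (X x)" for x using comF[OF X] by (simp add: commutes_def)
    have "commutes X Q" using X by (simp add: commutes_def Q_apply XF blinfun.bilinear_simps)
    then show ?thesis using \<open>i \<le> Suc n\<close> comP'[of "i - 1" X]
      by (cases i) (auto simp: commutes_def P0 PS XF blinfun.bilinear_simps)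
  qed
  moreover have "0 \<le> inner (R x - step_op e (Suc n) P x) x
      \<and> inner (R x - step_op e (Suc n) P x) x \<le> e * (norm x)\<^sup>2" for x
  proof -
    define y where "y = x - F x"
    have x: "x = F x + y" and Fy: "F y = 0" by (simp_all add: y_def blinfun.bilinear_simps FF)
    have "step_op e (Suc n) P x = step_op e n P' (F x) + e *\<^sub>R (\<Sum>i\<le>n. P' i (F x))"
      unfolding step_op_apply sum.atMost_Suc_shift
      by (simp add: PS scaleR_sum_right sum.distrib[symmetric] algebra_simps)
    then have step: "step_op e (Suc n) P x = step_op e n P' (F x) + e *\<^sub>R F x"
      using P' by (simp add: orth_resolution_def)
    have "step_op e n P' (F x) = F (step_op e n P' (F x))"
      by (simp add: step_op_apply blinfun.bilinear_simps blinfun.sum_right FP' FF)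
    then have in_step: "inner (step_op e n P' (F x)) x = inner (step_op e n P' (F x)) (F x)"
      by (metis Fin)
    have "inner (R (F x)) y = 0" by (metis RF Fin Fy inner_zero_right)
    moreover from this have "inner (R y) (F x) = 0" by (metis Rin inner_commute)
    ultimately have in_R: "inner (R x) x = inner (R (F x)) (F x) + inner (R y) y"
      by (subst (1 2) x) (simp add: blinfun.bilinear_simps inner_add_left inner_add_right)
    have "inner (R x - step_op e (Suc n) P x) x
        = inner (Q (F x) - step_op e n P' (F x)) (F x) + inner (R y) y"
      by (simp add: step in_step in_R inner_diff_left inner_add_left Q_apply FF Fin)
    moreover have "0 \<le> inner (R y) y" "inner (R y) y \<le> e * (norm y)\<^sup>2"
      using R(2) up[of x] by (simp_all add: y_def)
    moreover have "e * (norm x)\<^sup>2 = e * (norm (F x))\<^sup>2 + e * (norm y)\<^sup>2"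
      using pyth[of x] by (simp add: y_def algebra_simps)
    ultimately show ?thesis using form[of "F x"] by linarith
  qed
  ultimately show ?case by blast
qed

section \<open>Operators close to a given one that are isometric up to steps\<close>

text \<open>
  Coercivity bounds \<open>G\<close> from below, so its range is closed; and a vector \<open>y\<close> orthogonal to the range has
  \<open>\<langle>G y, y\<rangle> = 0\<close>, hence is zero.
\<close>

lemma coercive_inverse:
  fixes G :: "'a::{real_inner,banach} \<Rightarrow>\<^sub>L 'a"
  assumes G: "self_adjoint G" and c: "c > 0" and coercive: "\<And>x. c * (norm x)\<^sup>2 \<le> inner (G x) x"
  shows "\<exists>H. \<forall>x. G (blinfun_apply H x) = x \<and> H (G x) = x"
proof -
  have below: "c * norm x \<le> norm (G x)" for x
  proof (cases "x = 0")
    case False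
    have "c * (norm x)\<^sup>2 \<le> norm (G x) * norm x"
      using coercive[of x] norm_cauchy_schwarz[of "G x" x] by linarith
    then show ?thesis using False by (simp add: power2_eq_square mult.assoc[symmetric])
  qed simp
  have "inj G"
  proof (rule injI)
    fix x y assume "G x = G y"
    then have "c * norm (x - y) \<le> 0" using below[of "x - y"] by (simp add: blinfun.bilinear_simps)
    then show "x = y" using c by (simp add: mult_le_0_iff)
  qed
  have "subspace (range G)"
    by (intro linear_subspace_image subspace_UNIV bounded_linear.linear blinfun.bounded_linear_right)
  moreover have "complete (range G)"
    by (rule complete_isometric_image[OF c])
      (use below in \<open>auto intro: blinfun.bounded_linear_right simp: mult.commute complete_UNIV\<close>)
  then have "closed (range G)" by (rule complete_imp_closed)
  ultimately have M: "subspace (range G)" "closed (range G)" by auto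
  have "x \<in> range G" for x
  proof -
    define y where "y = x - orth_proj (range G) x"
    have "inner (G y) y = 0"
      using orth_proj_diff[OF M, of x] by (auto simp: y_def orthogonal_comp_def orthogonal_def)
    then have "y = 0" using coercive[of y] c by (simp add: mult_le_0_iff)
    then show ?thesis using orth_proj_in[OF M, of x] by (simp add: y_def)
  qed
  then have "surj G" by blast
  have GH: "G (inv G x) = x" and HG: "inv G (G x) = x" for x
    using \<open>inj G\<close> \<open>surj G\<close> by (simp_all add: surj_f_inv_f)
  have "bounded_linear (inv G)"
  proof (rule bounded_linear_intro[where K = "inverse c"])
    show "inv G (x + y) = inv G x + inv G y" for x y
      by (metis GH HG blinfun.add_right)
    show "inv G (r *\<^sub>R x) = r *\<^sub>R inv G x" for r x
      by (metis GH HG blinfun.scaleR_right)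
    show "norm (inv G x) \<le> norm x * inverse c" for x
      using below[of "inv G x"] c by (simp add: GH field_simps)
  qed
  then show ?thesis
    by (intro exI[of _ "Blinfun (inv G)"]) (simp add: bounded_linear_Blinfun_apply GH HG)
qed

text \<open>
  Let \<open>R\<close> be the modulus of \<open>T\<close> and \<open>D\<close> a step operator within \<open>e\<close> of \<open>R\<close>. If \<open>T = U R\<close> is the polar
  decomposition, then \<open>S = U D\<close> is what is wanted. The partial isometry \<open>U\<close> is avoided: \<open>D\<close> vanishes on
  the range of \<open>P 0\<close>, and on the orthogonal complement of that range \<open>R \<ge> D \<ge> e\<close> is invertible, so that
  \<open>S = T R\<^sup>-\<^sup>1 D\<close> makes sense. To have an operator that is invertible on the whole space, \<open>R\<close> is replaced
  by \<open>G = R + P 0\<close>.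
\<close>

lemma step_isometric_approximation:
  fixes T :: "'a::{real_inner,banach} \<Rightarrow>\<^sub>L 'a"
  assumes e: "e > 0"
  shows "\<exists>S n P. orth_resolution n P \<and> (\<forall>x. norm (blinfun_apply S x) = norm (step_op e n P x))
    \<and> norm (T - S) \<le> e
    \<and> (\<forall>X. commutes X T \<longrightarrow> commutes X (adjoint_op T) \<longrightarrow> commutes X S)"
proof -
  obtain R where saR: "self_adjoint R" and posR: "\<And>x. inner (R x) x \<ge> 0"
    and inR: "\<And>x y. inner (R x) (R y) = inner (T x) (T y)"
    and comR: "\<And>X. commutes X (adjoint_op T o\<^sub>L T) \<Longrightarrow> commutes X R"
    using modulus_exists[of T] by blast
  have normR: "norm (R x) = norm (T x)" for x by (simp add: norm_eq_sqrt_inner inR)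
  obtain n where n: "norm T < real n * e" using reals_Archimedean3[OF e] by blast
  have "0 \<le> inner (R x) x \<and> inner (R x) x \<le> real (Suc n) * e * (norm x)\<^sup>2" for x
  proof -
    have "inner (R x) x \<le> norm (T x) * norm x" using norm_cauchy_schwarz[of "R x" x] by (simp add: normR)
    also have "\<dots> \<le> (norm T * norm x) * norm x" by (intro mult_right_mono norm_blinfun) simp
    also have "\<dots> \<le> (real (Suc n) * e * norm x) * norm x"
      using n e by (intro mult_right_mono) (auto simp: algebra_simps)
    finally show ?thesis using posR by (simp add: power2_eq_square mult.assoc)
  qed
  from step_approximation[OF e saR this] obtain P where P: "orth_resolution n P"
    and comP: "\<And>i X. i \<le> n \<Longrightarrow> commutes X R \<Longrightarrow> commutes X (P i)"
    and form: "\<And>x. 0 \<le> inner (R x - step_op e n P x) x"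
      "\<And>x. inner (R x - step_op e n P x) x \<le> e * (norm x)\<^sup>2"
    by blast
  define D where "D = step_op e n P"
  have D_apply: "D x = (\<Sum>i\<le>n. (real i * e) *\<^sub>R P i x)" for x by (simp add: D_def step_op_apply)
  have Pin: "inner (P i x) y = inner x (P i y)" if "i \<le> n" for i x y
    using P that by (simp add: orth_resolution_def self_adjoint_def)
  have PP: "P i (P j x) = (if i = j then P i x else 0)" if "i \<le> n" "j \<le> n" for i j x
    using P that by (simp add: orth_resolution_def)
  have sumP: "(\<Sum>i\<le>n. P i x) = x" for x using P by (simp add: orth_resolution_def)
  have saD: "self_adjoint D"
    by (simp add: self_adjoint_def D_apply inner_sum_left inner_sum_right Pin)
  have "self_adjoint (R - D)" using saR saD
    by (simp add: self_adjoint_def blinfun.bilinear_simps inner_diff_left inner_diff_right)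
  then have RD: "norm (R x - D x) \<le> e * norm x" for x
    using norm_le_of_form_bounds[of "R - D" e x] form e
    by (simp add: blinfun.bilinear_simps D_def)
  have P0D: "P 0 (D x) = 0" for x
    by (auto simp: D_apply blinfun.sum_right blinfun.scaleR_right PP intro!: sum.neutral)
  have RP: "R (P 0 x) = P 0 (R x)" for x using comP[of 0 R] by (simp add: commutes_def)
  \<comment> \<open>\<open>\<langle>G x, x\<rangle> \<ge> \<langle>D x, x\<rangle> + \<parallel>P 0 x\<parallel>\<^sup>2\<close>, and \<open>D\<close> is at least \<open>e\<close> on the ranges of the
    other projections; this gives the coercivity constant \<open>min e 1\<close>.\<close>
  define G where "G = R + P 0"
  have G_apply: "G x = R x + P 0 x" for x by (simp add: G_def blinfun.bilinear_simps)
  have saG: "self_adjoint G" using saR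
    by (simp add: self_adjoint_def G_apply inner_add_left inner_add_right Pin)
  have "min e 1 * (norm x)\<^sup>2 \<le> inner (G x) x" for x
  proof -
    have inP: "inner (P i x) x = (norm (P i x))\<^sup>2" if "i \<le> n" for i
      using that by (metis PP Pin power2_norm_eq_inner)
    have "(norm x)\<^sup>2 = (\<Sum>i\<le>n. inner (P i x) x)"
      by (simp add: inner_sum_left[symmetric] sumP power2_norm_eq_inner)
    then have "min e 1 * (norm x)\<^sup>2 = (\<Sum>i\<le>n. min e 1 * (norm (P i x))\<^sup>2)"
      by (simp add: inP sum_distrib_left)
    also have "\<dots> \<le> (\<Sum>i\<le>n. (if i = 0 then (norm (P i x))\<^sup>2 else 0) + (real i * e) * (norm (P i x))\<^sup>2)"
    proof (rule sum_mono)
      fix i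
      have "min e 1 \<le> real i * e" if "i \<noteq> 0"
        using that e mult_right_mono[of 1 "real i" e] by (simp add: min.coboundedI1)
      then show "min e 1 * (norm (P i x))\<^sup>2
          \<le> (if i = 0 then (norm (P i x))\<^sup>2 else 0) + (real i * e) * (norm (P i x))\<^sup>2"
        using mult_right_mono[of "min e 1" 1 "(norm (P i x))\<^sup>2"]
        by (auto intro: mult_right_mono)
    qed
    also have "\<dots> = inner (P 0 x) x + inner (D x) x"
      by (simp add: sum.distrib D_apply inner_sum_left inP)
    also have "\<dots> \<le> inner (G x) x"
      using form(1)[of x] by (simp add: G_apply D_def inner_add_left inner_diff_left)
    finally show ?thesis .
  qed
  then obtain H where GH: "\<And>x. G (blinfun_apply H x) = x" and HG: "\<And>x. blinfun_apply H (G x) = x"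
    using coercive_inverse[OF saG, of "min e 1"] e by auto
  \<comment> \<open>The vector \<open>H (D x)\<close> has no component in the range of \<open>P 0\<close>, where \<open>G\<close> and \<open>R\<close> differ.\<close>
  have RHD: "R (H (D x)) = D x" for x
  proof -
    have "G (P 0 (H (D x))) = P 0 (G (H (D x)))"
      by (simp add: G_apply RP blinfun.bilinear_simps)
    also have "\<dots> = 0" by (simp add: GH P0D)
    finally have "P 0 (H (D x)) = 0" by (metis HG blinfun.zero_right)
    then show ?thesis using GH[of "D x"] by (simp add: G_apply)
  qed
  define S where "S = T o\<^sub>L (H o\<^sub>L D)"
  have S_apply: "S x = T (H (D x))" for x by (simp add: S_def)
  have normS: "norm (S x) = norm (D x)" for x by (simp add: S_apply normR[symmetric] RHD)
  have "norm (T - S) \<le> e"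
  proof (rule norm_blinfun_bound)
    fix x
    have "norm ((T - S) x) = norm (R (x - H (D x)))"
      unfolding normR by (simp add: S_apply blinfun.bilinear_simps)
    also have "\<dots> = norm (R x - D x)" by (simp add: blinfun.bilinear_simps RHD)
    finally show "norm ((T - S) x) \<le> e * norm x" using RD by simp
  qed (use e in simp)
  moreover have "commutes X S" if X: "commutes X T" "commutes X (adjoint_op T)" for X
  proof -
    have XR: "commutes X R" using X by (intro comR) (simp add: commutes_def)
    have XP: "X (P i x) = P i (X x)" if "i \<le> n" for i x
      using comP[OF that XR] by (simp add: commutes_def)
    then have XD: "X (D x) = D (X x)" for x
      by (simp add: D_apply blinfun.sum_right blinfun.scaleR_right)
    have "X (G x) = G (X x)" for x
      using XR XP[of 0] by (simp add: G_apply commutes_def blinfun.bilinear_simps)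
    then have "X (H x) = H (X x)" for x by (metis GH HG)
    then show ?thesis using X XD by (simp add: commutes_def S_apply)
  qed
  ultimately show ?thesis using P normS unfolding D_def by blast
qed

section \<open>Norm attainment on reducing subspaces\<close>

text \<open>
  By polarization \<open>\<langle>S x, S y\<rangle> = \<langle>D\<^sup>2 x, y\<rangle>\<close>, so a subspace \<open>M\<close> that reduces \<open>S\<close> also reduces \<open>D\<^sup>2\<close>. The
  eigenvalues \<open>(i e)\<^sup>2\<close> of \<open>D\<^sup>2\<close> are distinct, so the projection onto \<open>M\<close> preserves each eigenspace, the
  range of \<open>P i\<close>; hence \<open>P i\<close> maps \<open>M\<close> into \<open>M\<close>. If \<open>k\<close> is the largest index with \<open>P k\<close> nonzero on \<open>M\<close>, the
  norm of \<open>S\<close> on \<open>M\<close> is \<open>k e\<close>, and every unit vector of \<open>M\<close> in the range of \<open>P k\<close> attains it.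
\<close>

lemma step_isometric_attains_norm:
  fixes S :: "'a::{real_inner,banach} \<Rightarrow>\<^sub>L 'a"
  assumes e: "e > 0" and P: "orth_resolution n P"
    and normS: "\<And>x. norm (S x) = norm (step_op e n P x)"
    and M: "subspace M" "closed M" "M \<noteq> {0}"
    and SM: "S ` M \<subseteq> M" "S ` (M\<^sup>\<bottom>) \<subseteq> M\<^sup>\<bottom>"
  shows "\<exists>x\<in>M. norm x = 1 \<and> (\<forall>y\<in>M. norm y = 1 \<longrightarrow> norm (S y) \<le> norm (S x))"
proof -
  define D where "D = step_op e n P"
  have D_apply: "D x = (\<Sum>i\<le>n. (real i * e) *\<^sub>R P i x)" for x by (simp add: D_def step_op_apply)
  have Pin: "inner (P i x) y = inner x (P i y)" if "i \<le> n" for i x y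
    using P that by (simp add: orth_resolution_def self_adjoint_def)
  have PP: "P i (P j x) = (if i = j then P i x else 0)" if "i \<le> n" "j \<le> n" for i j x
    using P that by (simp add: orth_resolution_def)
  have sumP: "(\<Sum>i\<le>n. P i x) = x" for x using P by (simp add: orth_resolution_def)
  have Din: "inner (D x) y = inner x (D y)" for x y
    by (simp add: D_apply inner_sum_left inner_sum_right Pin)
  have PD: "P i (D x) = (real i * e) *\<^sub>R P i x" if "i \<le> n" for i x
    using that by (simp add: D_apply blinfun.sum_right blinfun.scaleR_right PP if_distrib
        sum.delta cong: if_cong)
  have DP: "D (P i x) = (real i * e) *\<^sub>R P i x" if "i \<le> n" for i x
    using that by (simp add: D_apply PP if_distrib sum.delta cong: if_cong)
  have normD: "(norm (D x))\<^sup>2 = (\<Sum>i\<le>n. (real i * e)\<^sup>2 * (norm (P i x))\<^sup>2)" for x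
    unfolding D_def by (rule norm_step_op[OF P])
  have normP: "(norm x)\<^sup>2 = (\<Sum>i\<le>n. (norm (P i x))\<^sup>2)" for x
  proof -
    have "(norm x)\<^sup>2 = (\<Sum>i\<le>n. inner (P i x) x)"
      by (simp add: inner_sum_left[symmetric] sumP power2_norm_eq_inner)
    also have "\<dots> = (\<Sum>i\<le>n. (norm (P i x))\<^sup>2)"
      by (intro sum.cong refl) (metis PP Pin power2_norm_eq_inner atMost_iff)
    finally show ?thesis .
  qed
  have SD: "inner (S x) (S y) = inner (D x) (D y)" for x y
  proof -
    have "(norm (S (x + y)))\<^sup>2 = (norm (D (x + y)))\<^sup>2" "(norm (S x))\<^sup>2 = (norm (D x))\<^sup>2"
      "(norm (S y))\<^sup>2 = (norm (D y))\<^sup>2"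
      by (simp_all add: normS D_def)
    then show ?thesis
      by (simp add: blinfun.add_right power2_norm_eq_inner inner_add_left inner_add_right inner_commute)
  qed
  define Q where "Q = orth_proj M"
  have QM: "Q x \<in> M" and Qperp: "x - Q x \<in> M\<^sup>\<bottom>" for x
    unfolding Q_def by (rule orth_proj_in[OF M(1,2)], rule orth_proj_diff[OF M(1,2)])
  have orth: "inner (D (D x)) z = 0" if "x \<in> M" "z \<in> M\<^sup>\<bottom>" for x z
  proof -
    have "inner (S x) (S z) = 0"
      using SM that by (auto simp: orthogonal_comp_def orthogonal_def image_subset_iff)
    then show ?thesis by (simp add: SD Din)
  qed
  have QD: "Q (D (D x)) = D (D (Q x))" for x
  proof -
    let ?u = "x - Q x"
    \<comment> \<open>\<open>D\<^sup>2\<close> maps \<open>M\<close> into the bicomplement of \<open>M\<close>, which is \<open>M\<close> as \<open>M\<close> is closed.\<close>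
    have DM: "D (D (Q x)) \<in> M"
    proof -
      let ?v = "D (D (Q x))"
      have "inner (?v - Q ?v) (?v - Q ?v) = 0"
        using orth[OF QM[of x] Qperp[of ?v]] QM[of ?v] Qperp[of ?v]
        by (simp add: inner_diff_left orthogonal_comp_def orthogonal_def)
      then show ?thesis using QM[of ?v] by simp
    qed
    have "D (D x) - D (D (Q x)) \<in> M\<^sup>\<bottom>"
      using orth[OF _ Qperp[of x]]
      by (auto simp: orthogonal_comp_def orthogonal_def Din blinfun.diff_right)
    then show ?thesis unfolding Q_def[symmetric]
      using orth_proj_unique[OF M(1,2) DM] by (simp add: Q_def)
  qed
  \<comment> \<open>Evaluating \<open>P j Q D\<^sup>2 P i\<close> with \<open>D\<^sup>2\<close> on either side of \<open>Q\<close> gives two different multiples of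
    the same vector.\<close>
  have PQP: "P j (Q (P i x)) = 0" if ij: "i \<le> n" "j \<le> n" "i \<noteq> j" for i j x
  proof -
    have "P j (Q (D (D (P i x)))) = ((real i * e) * (real i * e)) *\<^sub>R P j (Q (P i x))"
      using ij by (simp add: DP blinfun.scaleR_right)
    moreover have "P j (Q (D (D (P i x)))) = ((real j * e) * (real j * e)) *\<^sub>R P j (Q (P i x))"
      using ij by (simp add: QD PD)
    ultimately have "((real i * e) * (real i * e) - (real j * e) * (real j * e)) *\<^sub>R P j (Q (P i x)) = 0"
      by (simp only: scaleR_diff_left right_minus_eq)
    moreover have "(real i * e) * (real i * e) \<noteq> (real j * e) * (real j * e)"
    proof
      assume "(real i * e) * (real i * e) = (real j * e) * (real j * e)"
      then have "(real i * e)\<^sup>2 = (real j * e)\<^sup>2" by (simp add: power2_eq_square)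
      then have "real i * e = real j * e" using e by (simp add: power2_eq_iff_nonneg)
      then show False using e ij by simp
    qed
    ultimately show ?thesis by simp
  qed
  have PM: "P i x \<in> M" if x: "x \<in> M" and i: "i \<le> n" for i x
  proof -
    have Qx: "Q x = x" unfolding Q_def
      by (rule orth_proj_unique[OF M(1,2) x]) (simp add: subspace_0 subspace_orthogonal_comp)
    have "P i x = P i (Q (\<Sum>j\<le>n. P j x))" by (simp add: sumP Qx)
    also have "\<dots> = (\<Sum>j\<le>n. if j = i then P i (Q (P j x)) else 0)"
      unfolding blinfun.sum_right using i by (intro sum.cong refl) (auto simp: PQP)
    also have "\<dots> = (\<Sum>j\<le>n. P j (Q (P i x)))"
      using i by (subst sum.delta) (auto simp: PQP intro!: sum.neutral simp: sum.remove[of _ i])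
    also have "\<dots> = Q (P i x)" by (rule sumP)
    finally show ?thesis using QM by metis
  qed
  define I where "I = {i. i \<le> n \<and> (\<exists>x\<in>M. P i x \<noteq> 0)}"
  have finI: "finite I" by (rule finite_subset[of _ "{..n}"]) (auto simp: I_def)
  obtain m where m: "m \<in> M" "m \<noteq> 0" using M(1,3) subspace_0 by blast
  have "I \<noteq> {}"
  proof
    assume "I = {}"
    then have "(\<Sum>i\<le>n. P i m) = 0" using m by (intro sum.neutral) (auto simp: I_def)
    then show False using m by (simp add: sumP)
  qed
  define k where "k = Max I"
  have "k \<in> I" unfolding k_def by (rule Max_in[OF finI \<open>I \<noteq> {}\<close>])
  then obtain w where k: "k \<le> n" and w: "w \<in> M" "P k w \<noteq> 0" by (auto simp: I_def)
  define x where "x = (1 / norm (P k w)) *\<^sub>R P k w"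
  have "x \<in> M" unfolding x_def by (intro subspace_scale[OF M(1)] PM w k)
  have "norm x = 1" using w by (simp add: x_def)
  have "norm (S x) = real k * e"
    using k w e by (simp add: normS D_def[symmetric] x_def blinfun.scaleR_right DP)
  have "norm (S y) \<le> norm (S x)" if y: "y \<in> M" "norm y = 1" for y
  proof -
    have "(norm (S y))\<^sup>2 = (\<Sum>i\<le>n. (real i * e)\<^sup>2 * (norm (P i y))\<^sup>2)"
      by (simp add: normS D_def[symmetric] normD)
    also have "\<dots> \<le> (\<Sum>i\<le>n. (real k * e)\<^sup>2 * (norm (P i y))\<^sup>2)"
    proof (rule sum_mono)
      fix i assume "i \<in> {..n}"
      show "(real i * e)\<^sup>2 * (norm (P i y))\<^sup>2 \<le> (real k * e)\<^sup>2 * (norm (P i y))\<^sup>2"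
      proof (cases "P i y = 0")
        case False
        then have "i \<in> I" using \<open>i \<in> {..n}\<close> y by (auto simp: I_def)
        then have "i \<le> k" unfolding k_def by (rule Max_ge[OF finI])
        then show ?thesis using e by (intro mult_right_mono power_mono) auto
      qed simp
    qed
    also have "\<dots> = (real k * e)\<^sup>2" by (simp add: sum_distrib_left[symmetric] normP[symmetric] y)
    finally show ?thesis unfolding \<open>norm (S x) = real k * e\<close>
      by (rule power2_le_imp_le) (use e in simp)
  qed
  then show ?thesis using \<open>x \<in> M\<close> \<open>norm x = 1\<close> by blast
qed

section \<open>Passage to complex Hilbert spaces and density\<close>

instance complex_hilbert \<subseteq> banach ..

lemma inner_scaleC_left: "inner (c *\<^sub>C x) y = inner x (cnj c *\<^sub>C y)" for x y :: "'a::complex_inner"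
proof -
  have "cinner x (cnj c *\<^sub>C y) = c * cinner x y"
    by (subst (1 2) cinner_commute) (simp add: cinner_scaleC_left)
  then show ?thesis by (simp add: inner_eq_Re_cinner cinner_scaleC_left)
qed

lemma norm_scaleC: "norm (c *\<^sub>C x) = cmod c * norm x" for x :: "'a::complex_inner"
proof -
  have "inner (c *\<^sub>C x) (c *\<^sub>C x) = inner x (complex_of_real ((cmod c)\<^sup>2) *\<^sub>C x)"
    unfolding inner_scaleC_left scaleC_scaleC complex_norm_square by (simp add: mult.commute)
  also have "\<dots> = (cmod c)\<^sup>2 * inner x x" by (simp only: scaleC_of_real inner_scaleR_right)
  finally have "(norm (c *\<^sub>C x))\<^sup>2 = (cmod c * norm x)\<^sup>2"
    by (simp add: power2_norm_eq_inner power_mult_distrib)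
  then show ?thesis by (simp add: power2_eq_iff_nonneg)
qed

text \<open>
  Multiplication by a scalar as a real-linear operator, so that complex linearity becomes commutation
  with a family of operators.
\<close>

definition scaleC_op :: "complex \<Rightarrow> 'a::complex_inner \<Rightarrow>\<^sub>L 'a"
  where "scaleC_op c = Blinfun (scaleC c)"

lemma scaleC_op_apply [simp]: "scaleC_op c x = c *\<^sub>C x"
proof -
  have "bounded_linear (scaleC c :: 'a \<Rightarrow> 'a)"
  proof (rule bounded_linear_intro[where K = "cmod c"])
    show "c *\<^sub>C (x + y) = c *\<^sub>C x + c *\<^sub>C y" for x y :: 'a by (rule scaleC_add_right)
    show "c *\<^sub>C (r *\<^sub>R x) = r *\<^sub>R (c *\<^sub>C x)" for r and x :: 'a
      by (simp only: scaleC_of_real[symmetric] scaleC_scaleC mult.commute)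
    show "norm (c *\<^sub>C x) \<le> norm x * cmod c" for x :: 'a by (simp add: norm_scaleC)
  qed
  then show ?thesis by (simp add: scaleC_op_def bounded_linear_Blinfun_apply)
qed

lemma bounded_operators_iff_commutes: "T \<in> bounded_operators \<longleftrightarrow> (\<forall>c. commutes (scaleC_op c) T)"
  by (auto simp: bounded_operators_def commutes_def)

text \<open>
  The adjoint is formed for the real inner product; the adjoint of multiplication by \<open>c\<close> is
  multiplication by the conjugate of \<open>c\<close>, which keeps complex linearity.
\<close>

lemma adjoint_op_bounded_operators:
  fixes T :: "'a::complex_hilbert \<Rightarrow>\<^sub>L 'a"
  assumes "T \<in> bounded_operators"
  shows "adjoint_op T \<in> bounded_operators"
proof -
  have "adjoint_op T (c *\<^sub>C x) = c *\<^sub>C adjoint_op T x" for c x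
    by (rule vector_eq_rdot[THEN iffD1])
      (use assms in \<open>simp add: inner_scaleC_left adjoint_op_inner bounded_operators_def\<close>)
  then show ?thesis by (simp add: bounded_operators_def)
qed

lemma csubspace_imp_subspace:
  fixes M :: "'a::complex_inner set"
  assumes "csubspace M"
  shows "subspace M"
  unfolding subspace_def
  using complex_vector.subspace_0[OF assms] complex_vector.subspace_add[OF assms]
    complex_vector.subspace_scale[OF assms] scaleC_of_real by metis

text \<open>
  The imaginary part of \<open>cinner x y\<close> is minus the real inner product of \<open>\<i> x\<close> with \<open>y\<close>, and \<open>\<i> x\<close> stays
  in a complex subspace.
\<close>

lemma ortho_compl_eq_orthogonal_comp:
  fixes M :: "'a::complex_inner set"
  assumes M: "csubspace M"
  shows "ortho_compl M = M\<^sup>\<bottom>"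
proof -
  have "cinner x y = 0" if y: "\<And>x. x \<in> M \<Longrightarrow> inner x y = 0" and x: "x \<in> M" for x y
  proof -
    have "inner (\<i> *\<^sub>C x) y = 0" using complex_vector.subspace_scale[OF M x] y by blast
    then show ?thesis
      using y[OF x] by (simp add: inner_eq_Re_cinner cinner_scaleC_left complex_eq_iff)
  qed
  then show ?thesis
    by (auto simp: ortho_compl_def orthogonal_comp_def orthogonal_def inner_eq_Re_cinner)
qed

lemma beta_class_approximation:
  fixes T :: "'a::complex_hilbert \<Rightarrow>\<^sub>L 'a"
  assumes T: "T \<in> bounded_operators" and e: "e > 0"
  shows "\<exists>S\<in>beta_class. norm (T - S) \<le> e"
proof -
  obtain S n P where P: "orth_resolution n P"
    and normS: "\<And>x. norm (blinfun_apply S x) = norm (step_op e n P x)"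
    and TS: "norm (T - S) \<le> e"
    and com: "\<And>X. commutes X T \<Longrightarrow> commutes X (adjoint_op T) \<Longrightarrow> commutes X S"
    using step_isometric_approximation[OF e, of T] by blast
  have S: "S \<in> bounded_operators"
    using T adjoint_op_bounded_operators[OF T] com by (simp add: bounded_operators_iff_commutes)
  have "norm_attaining_on S M" if red: "M \<in> reducing_subspaces S" and ne: "M \<noteq> {0}" for M
  proof -
    have M: "csubspace M" "closed M" "S ` M \<subseteq> M" "S ` ortho_compl M \<subseteq> ortho_compl M"
      using red by (auto simp: reducing_subspaces_def)
    obtain x where x: "x \<in> M" "norm x = 1"
      and max: "\<And>y. y \<in> M \<Longrightarrow> norm y = 1 \<Longrightarrow> norm (S y) \<le> norm (S x)"
      using step_isometric_attains_norm[OF e P normS csubspace_imp_subspace[OF M(1)] M(2) ne M(3)]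
        M(4) ortho_compl_eq_orthogonal_comp[OF M(1)] by auto
    have "restriction_norm S M = norm (S x)"
      unfolding restriction_norm_def by (rule cSup_eq_maximum) (use x max in auto)
    then show ?thesis using x by (auto simp: norm_attaining_on_def)
  qed
  then have "S \<in> beta_class" using S by (simp add: beta_class_def)
  then show ?thesis using TS by blast
qed

theorem theorem8p3:
  assumes infinite_dimensional: "\<nexists>B :: 'a::complex_hilbert set. finite B \<and> cspan B = UNIV"
    and separable: "separable_space (euclidean :: 'a topology)"
  shows "(top_of_set (bounded_operators :: ('a \<Rightarrow>\<^sub>L 'a) set)) closure_of beta_class
    = bounded_operators"
proof -
  have "T \<in> closure beta_class" if T: "T \<in> bounded_operators" for T :: "'a \<Rightarrow>\<^sub>L 'a"
    unfolding closure_approachable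
  proof (intro allI impI)
    fix e :: real assume "e > 0"
    then obtain S where "S \<in> beta_class" "norm (T - S) \<le> e / 2"
      using beta_class_approximation[OF T, of "e / 2"] by auto
    then show "\<exists>S\<in>beta_class. dist S T < e"
      using \<open>e > 0\<close> by (intro bexI[of _ S]) (auto simp: dist_norm norm_minus_commute)
  qed
  moreover have "bounded_operators \<inter> beta_class = (beta_class :: ('a \<Rightarrow>\<^sub>L 'a) set)"
    by (auto simp: beta_class_def)
  ultimately show ?thesis by (auto simp: closure_of_subtopology)
qed

end
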